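(* Let $k\ge 1$ be an integer and let $n=4k+16$, the order of the graph $H(k)$. Then $c_{\mathrm{ind}}(H(k))=n/2+2$.
   Context: All graphs are finite and simple. The induced cycles vertex number $c_{\mathrm{ind}}(G)$ of a graph $G$ is the largest size of a set $S\subseteq V(G)$ such that the subgraph induced by $S$ is $2$-regular, i.e. every vertex of $S$ has exactly two neighbours in $S$. For an integer $k\ge 1$, the graph $H(k)$ has the $16+4k$ distinct vertices $a_1,a_2$; $u^j_i$ ($1\le j\le 3$, $0\le i\le k+1$; $j$ is a superscript index); $m_i$ ($1\le i\le k$); $v_1,v_2,v_3$; $z_1,z_2,z_3$; $b_1,b_2$. Its edges are: $a_1u^j_0$ and $a_2u^j_0$ for $1\le j\le 3$; $u^j_{i-1}u^j_i$ for $1\le j\le 3$ and $1\le i\le k+1$; $m_iu^j_i$ for $1\le j\le 3$ and $1\le i\le k$; the triangle edges $u^1_{k+1}u^2_{k+1}$, $u^1_{k+1}v_1$, $u^2_{k+1}v_1$; the triangle edges $u^3_{k+1}v_2$, $u^3_{k+1}v_3$, $v_2v_3$; $v_jz_j$ for $1\le j\le 3$; $b_1z_j$ and $b_2z_j$ for $1\le j\le 3$. *)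

theory Defs
  imports Complex_Main "Graph_Theory.Graph_Theory"
begin

(* Undirected graphs are symmetric digraphs (locales graph and pair_graph), so an undirected
   edge is a pair of opposite arcs and the degree of a vertex is its out-degree. *)
definition regular_graph :: "nat \<Rightarrow> ('a, 'b) pre_digraph \<Rightarrow> bool" where
  "regular_graph d G \<longleftrightarrow> (\<forall>v \<in> verts G. out_degree G v = d)"

(* The empty set is admitted, so the value is 0 for graphs without an induced cycle. *)
definition c_ind :: "('a, 'b) pre_digraph \<Rightarrow> nat" where
  "c_ind G = Max {card S | S. S \<subseteq> verts G \<and> regular_graph 2 (G \<restriction> S)}"

lemma regular_graph_induce_iff:
  assumes "graph G" "S \<subseteq> verts G"
  shows "regular_graph d (G \<restriction> S) \<longleftrightarrow> (\<forall>v \<in> S. card {w \<in> S. v \<rightarrow>\<^bsub>G\<^esub> w} = d)"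
proof -
  interpret graph G by fact
  have "out_degree (G \<restriction> S) v = card {w \<in> S. v \<rightarrow>\<^bsub>G\<^esub> w}" if v: "v \<in> S" for v
  proof -
    have out: "out_arcs (G \<restriction> S) v = {e \<in> arcs G. tail G e = v \<and> head G e \<in> S}"
      unfolding out_arcs_def using v by auto
    have img: "head G ` out_arcs (G \<restriction> S) v = {w \<in> S. v \<rightarrow>\<^bsub>G\<^esub> w}"
      unfolding out arcs_ends_def arc_to_ends_def by blast
    have "inj_on (head G) (out_arcs (G \<restriction> S) v)"
      unfolding out using no_multi_arcs unfolding arc_to_ends_def by (intro inj_onI) simp
    then show ?thesis
      unfolding out_degree_def img[symmetric] by (simp add: card_image)
  qed
  then show ?thesis by (simp add: regular_graph_def)
qed

lemma
  assumes "finite (verts G)"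
  shows c_ind_attained: "\<exists>S \<subseteq> verts G. regular_graph 2 (G \<restriction> S) \<and> card S = c_ind G"
    and card_le_c_ind: "S \<subseteq> verts G \<Longrightarrow> regular_graph 2 (G \<restriction> S) \<Longrightarrow> card S \<le> c_ind G"
proof -
  let ?C = "{card S | S. S \<subseteq> verts G \<and> regular_graph 2 (G \<restriction> S)}"
  have fin: "finite ?C"
    using assms by (intro finite_subset[of ?C "card ` Pow (verts G)"]) auto
  have "card {} \<in> ?C" by (rule CollectI, rule exI[of _ "{}"]) (simp add: regular_graph_def)
  then have "?C \<noteq> {}" by blast
  from Max_in[OF fin this] have "c_ind G \<in> ?C" unfolding c_ind_def .
  then obtain T where "c_ind G = card T" "T \<subseteq> verts G" "regular_graph 2 (G \<restriction> T)"
    by (elim CollectE exE conjE)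
  then show "\<exists>S \<subseteq> verts G. regular_graph 2 (G \<restriction> S) \<and> card S = c_ind G"
    by (intro exI[of _ T]) simp
  show "card S \<le> c_ind G" if "S \<subseteq> verts G" "regular_graph 2 (G \<restriction> S)"
    unfolding c_ind_def by (rule Max_ge[OF fin]) (use that in blast)
qed

(* U j i stands for the vertex u with superscript j and subscript i. *)
datatype H_vertex = A nat | U nat nat | M nat | V nat | Z nat | B nat

definition H_verts :: "nat \<Rightarrow> H_vertex set" where
  "H_verts k =
     {A 1, A 2}
     \<union> {U j i | j i. 1 \<le> j \<and> j \<le> 3 \<and> i \<le> k + 1}
     \<union> {M i | i. 1 \<le> i \<and> i \<le> k}
     \<union> {V 1, V 2, V 3} \<union> {Z 1, Z 2, Z 3} \<union> {B 1, B 2}"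

(* Each edge listed in one direction only. *)
definition H_edges :: "nat \<Rightarrow> (H_vertex \<times> H_vertex) set" where
  "H_edges k =
     {(A 1, U j 0) | j. 1 \<le> j \<and> j \<le> 3}
     \<union> {(A 2, U j 0) | j. 1 \<le> j \<and> j \<le> 3}
     \<union> {(U j (i - 1), U j i) | j i. 1 \<le> j \<and> j \<le> 3 \<and> 1 \<le> i \<and> i \<le> k + 1}
     \<union> {(M i, U j i) | j i. 1 \<le> j \<and> j \<le> 3 \<and> 1 \<le> i \<and> i \<le> k}
     \<union> {(U 1 (k + 1), U 2 (k + 1)), (U 1 (k + 1), V 1), (U 2 (k + 1), V 1)}
     \<union> {(U 3 (k + 1), V 2), (U 3 (k + 1), V 3), (V 2, V 3)}
     \<union> {(V j, Z j) | j. 1 \<le> j \<and> j \<le> 3}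
     \<union> {(B 1, Z j) | j. 1 \<le> j \<and> j \<le> 3}
     \<union> {(B 2, Z j) | j. 1 \<le> j \<and> j \<le> 3}"

definition H :: "nat \<Rightarrow> H_vertex pair_pre_digraph" where
  "H k = \<lparr> pverts = H_verts k, parcs = H_edges k \<union> (H_edges k)\<inverse> \<rparr>"

lemma H_verts_eq:
  "H_verts k =
     A ` {1, 2} \<union> (\<lambda>(j, i). U j i) ` ({1..3} \<times> {..k + 1}) \<union> M ` {1..k}
     \<union> V ` {1, 2, 3} \<union> Z ` {1, 2, 3} \<union> B ` {1, 2}"
  unfolding H_verts_def by auto

lemma H_verts_iff [simp]:
  "A i \<in> H_verts k \<longleftrightarrow> i = 1 \<or> i = 2"
  "U j i \<in> H_verts k \<longleftrightarrow> 1 \<le> j \<and> j \<le> 3 \<and> i \<le> k + 1"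
  "M i \<in> H_verts k \<longleftrightarrow> 1 \<le> i \<and> i \<le> k"
  "V i \<in> H_verts k \<longleftrightarrow> i = 1 \<or> i = 2 \<or> i = 3"
  "Z i \<in> H_verts k \<longleftrightarrow> i = 1 \<or> i = 2 \<or> i = 3"
  "B i \<in> H_verts k \<longleftrightarrow> i = 1 \<or> i = 2"
  by (simp_all add: H_verts_def)

lemma card_H_verts: "card (H_verts k) = 4 * k + 16"
proof -
  let ?U = "(\<lambda>(j, i). U j i) ` ({1..3} \<times> {..k + 1})"
  let ?M = "M ` {1..k}"
  let ?F = "A ` {1, 2} \<union> V ` {1, 2, 3} \<union> Z ` {1, 2, 3} \<union> B ` {1, 2}"
  have "H_verts k = ?U \<union> ?M \<union> ?F"
    unfolding H_verts_eq by (simp only: Un_ac)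
  also have "card \<dots> = card (?U \<union> ?M) + card ?F"
    by (rule card_Un_disjoint) auto
  also have "card (?U \<union> ?M) = card ?U + card ?M"
    by (rule card_Un_disjoint) auto
  also have "card ?U = 3 * (k + 2)"
    by (subst card_image) (auto simp: inj_on_def card_cartesian_product)
  also have "card ?M = k"
    by (subst card_image) (auto simp: inj_on_def)
  also have "card ?F = 10"
    by simp
  finally show ?thesis by simp
qed

lemma order_H: "card (verts (with_proj (H k))) = 4 * k + 16"
  by (simp add: H_def card_H_verts)

lemma pair_graph_H: "pair_graph (H k)"
proof -
  have E: "H_edges k \<subseteq> H_verts k \<times> H_verts k"
    unfolding H_edges_def by auto
  have fin: "finite (H_verts k)" unfolding H_verts_eq by auto
  have noloop: "(v, v) \<notin> H_edges k" for v
    unfolding H_edges_def by auto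
  have "sym (H_edges k \<union> (H_edges k)\<inverse>)" by (auto simp: sym_def)
  moreover have "finite (H_edges k)"
    by (rule finite_subset[OF E finite_cartesian_product[OF fin fin]])
  ultimately show ?thesis
    using E fin noloop
    by unfold_locales (fastforce simp: H_def symmetric_def)+
qed

end

theory Submission
  imports Defs
begin

text \<open>
  Since \<open>n / 2 + 2 = 2 * k + 10\<close>, the claim is that about two vertices per column can be used, a column
  being \<open>U 1 i\<close>, \<open>U 2 i\<close>, \<open>U 3 i\<close> together with \<open>M i\<close>.

  Let \<open>S\<close> induce a 2-regular subgraph, and let \<open>C i\<close> be the set of those \<open>j\<close> for which \<open>U j i\<close> is in
  \<open>S\<close>. Sweeping from the vertices \<open>A 1\<close>, \<open>A 2\<close> through the columns, only three situations ever occur: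
  \<open>C i\<close> is empty; or it has two elements, both of whose rows continue into column \<open>i + 1\<close>; or it has
  two elements, both of whose rows stop at column \<open>i\<close>. The reason is that \<open>M i\<close> joins \<open>S\<close> only when
  \<open>C i\<close> has exactly two elements, and that it supplies the same amount of degree to every element of
  \<open>C i\<close>. The number of vertices of \<open>S\<close> met so far exceeds \<open>2 * i\<close> by at most 2, 3 and 4 in these
  three situations. This is the invariant \<open>profile\<close>, which is set up by the \<open>K\<^bsub>2,3\<^esub>\<close> at the left end
  (\<open>profile_cap\<close>) and passes from each column to the next (\<open>profile_step\<close>).

  The right end, formed by the vertices \<open>Z\<close> and \<open>B\<close>, is the same \<open>K\<^bsub>2,3\<^esub>\<close> read backwards, so it has a
  profile as well. Between the two profiles lie just the two triangles, and \<open>two_triangles_le\<close>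
  shows that triangles and profiles together account for at most 10 vertices beyond \<open>2 * k\<close>.

  The bound is attained by two disjoint cycles: one of length \<open>2 * k + 5\<close> that runs along the first two
  rows, and one of length 5 at the right end.
\<close>

section \<open>Counting neighbours in a cubic graph\<close>

text \<open>
  The graph is cubic. With the three neighbours of each vertex in an explicit list, the degree of a
  vertex in an induced subgraph becomes a sum of three indicators. The order within the lists is the
  order of the summands in \<open>profile_cap\<close>, \<open>profile_step\<close> and \<open>two_triangles_le\<close>. Only labels of
  actual vertices matter, so the last branch for \<open>U\<close> and for \<open>V\<close> stands for label 3.
\<close>
fun H_nbs :: "nat \<Rightarrow> H_vertex \<Rightarrow> H_vertex list" where
  "H_nbs k (A a) = [U 1 0, U 2 0, U 3 0]"
| "H_nbs k (U j i) =
     (if i = 0 then [A 1, A 2, U j 1]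
      else if i \<le> k then [M i, U j (i - 1), U j (i + 1)]
      else if j = 1 then [U 1 k, U 2 (k + 1), V 1]
      else if j = 2 then [U 2 k, U 1 (k + 1), V 1]
      else [U 3 k, V 2, V 3])"
| "H_nbs k (M i) = [U 1 i, U 2 i, U 3 i]"
| "H_nbs k (V j) =
     (if j = 1 then [Z 1, U 1 (k + 1), U 2 (k + 1)]
      else if j = 2 then [Z 2, U 3 (k + 1), V 3]
      else [Z 3, U 3 (k + 1), V 2])"
| "H_nbs k (Z j) = [B 1, B 2, V j]"
| "H_nbs k (B b) = [Z 1, Z 2, Z 3]"

lemma distinct_H_nbs: "distinct (H_nbs k v)"
  by (cases v) auto

lemma indices_le_3: "Suc 0 \<le> j \<and> j \<le> 3 \<longleftrightarrow> j = 1 \<or> j = 2 \<or> j = (3::nat)"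
  by auto

lemma dominates_H_iff:
  assumes "v \<in> H_verts k"
  shows "v \<rightarrow>\<^bsub>with_proj (H k)\<^esub> w \<longleftrightarrow> w \<in> set (H_nbs k v)"
proof -
  have "v \<rightarrow>\<^bsub>with_proj (H k)\<^esub> w \<longleftrightarrow> (v, w) \<in> H_edges k \<or> (w, v) \<in> H_edges k"
    by (simp add: H_def arcs_ends_def arc_to_ends_def)
  also have "\<dots> \<longleftrightarrow> w \<in> set (H_nbs k v)"
    using assms by (cases v; cases w) (auto simp: H_edges_def indices_le_3)
  finally show ?thesis .
qed

lemma card_Int_set_distinct:
  assumes "distinct xs"
  shows "card (S \<inter> set xs) = sum_list (map (\<lambda>x. of_bool (x \<in> S)) xs)"
  using assms by (induction xs) auto

lemma regular_2_induced_H_iff: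
  assumes "S \<subseteq> H_verts k"
  shows "regular_graph 2 (with_proj (H k) \<restriction> S) \<longleftrightarrow>
    (\<forall>v \<in> S. sum_list (map (\<lambda>w. of_bool (w \<in> S)) (H_nbs k v)) = (2::nat))"
proof -
  interpret pair_graph "H k" by (rule pair_graph_H)
  have "card {w \<in> S. v \<rightarrow>\<^bsub>with_proj (H k)\<^esub> w} =
      sum_list (map (\<lambda>w. of_bool (w \<in> S)) (H_nbs k v))" if "v \<in> S" for v
  proof -
    have "{w \<in> S. v \<rightarrow>\<^bsub>with_proj (H k)\<^esub> w} = S \<inter> set (H_nbs k v)"
      using dominates_H_iff that assms by blast
    then show ?thesis by (simp only: card_Int_set_distinct distinct_H_nbs)
  qed
  moreover have "S \<subseteq> verts (with_proj (H k))" using assms by (simp add: H_def)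
  ultimately show ?thesis
    using regular_graph_induce_iff[OF graph_axioms] by simp
qed

lemma card_filter_123:
  "card {j \<in> {1,2,3::nat}. P j} = of_bool (P 1) + of_bool (P 2) + of_bool (P 3)"
  using card_Int_set_distinct[of "[1,2,3]" "Collect P"] by (simp add: Int_def conj_commute)

lemma card_subset_123:
  assumes "C \<subseteq> {1,2,3::nat}"
  shows "card C = of_bool (1 \<in> C) + of_bool (2 \<in> C) + of_bool (3 \<in> C)"
  using card_Int_set_distinct[of "[1,2,3]" C] assms by (simp add: Int_absorb2)

lemma card_subset_H_verts:
  assumes "S \<subseteq> H_verts k"
  shows "card S = of_bool (A 1 \<in> S) + of_bool (A 2 \<in> S)
    + (\<Sum>i\<le>k + 1. card {j \<in> {1,2,3}. U j i \<in> S}) + (\<Sum>i=1..k. of_bool (M i \<in> S))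
    + card {j \<in> {1,2,3}. V j \<in> S} + card {j \<in> {1,2,3}. Z j \<in> S}
    + of_bool (B 1 \<in> S) + of_bool (B 2 \<in> S)"
proof -
  define s :: "H_vertex \<Rightarrow> nat" where "s v = of_bool (v \<in> S)" for v
  have fin: "finite (H_verts k)" by (simp add: H_verts_eq)
  have filter3: "card {j \<in> {1,2,3}. f j \<in> S} = (\<Sum>j\<in>{1,2,3}. s (f j))" for f :: "nat \<Rightarrow> H_vertex"
    unfolding s_def card_filter_123 by simp
  have "card S = (\<Sum>v\<in>H_verts k. s v)"
    using fin assms by (simp add: s_def Int_absorb1)
  also have "\<dots> = sum s (A ` {1,2}) + sum s ((\<lambda>(j, i). U j i) ` ({1..3} \<times> {..k + 1}))
      + sum s (M ` {1..k}) + sum s (V ` {1,2,3}) + sum s (Z ` {1,2,3}) + sum s (B ` {1,2})"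
    unfolding H_verts_eq
    by (subst sum.union_disjoint, (simp; fail), (simp; fail), fastforce)+ (simp only:)
  also have "sum s ((\<lambda>(j, i). U j i) ` ({1..3} \<times> {..k + 1})) =
      (\<Sum>(j, i)\<in>{1..3} \<times> {..k + 1}. s (U j i))"
    by (subst sum.reindex) (auto simp: inj_on_def intro!: sum.cong)
  also have "\<dots> = (\<Sum>i\<le>k + 1. \<Sum>j\<in>{1..3}. s (U j i))"
    by (subst sum.swap) (rule sum.cartesian_product[symmetric])
  also have "{1..3} = {1, 2, 3::nat}" by auto
  also have "(\<Sum>i\<le>k + 1. \<Sum>j\<in>{1,2,3}. s (U j i)) = (\<Sum>i\<le>k + 1. card {j \<in> {1,2,3}. U j i \<in> S})"
    unfolding filter3 ..
  also have "sum s (M ` {1..k}) = (\<Sum>i=1..k. s (M i))"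
    by (subst sum.reindex) (auto simp: inj_on_def)
  finally show ?thesis unfolding filter3[of V] filter3[of Z] by (simp add: s_def del: sum_of_bool_eq)
qed

section \<open>The profile of a column\<close>

text \<open>
  \<open>C\<close> stands for the selected rows of one column, \<open>D\<close> for those of the next, and \<open>w\<close> for the surplus of
  the selection up to the first of these columns over two vertices per column, the initial column not
  being deducted. Two rows that stop may have gained one vertex more than two that continue, but they
  pay for it with the empty column that they force.
\<close>
definition profile :: "nat set \<Rightarrow> nat set \<Rightarrow> nat \<Rightarrow> bool" where
  "profile C D w \<longleftrightarrow>
     C = {} \<and> w \<le> 2 \<or> card C = 2 \<and> C \<subseteq> D \<and> w \<le> 3 \<or> card C = 2 \<and> C \<inter> D = {} \<and> w \<le> 4"

lemma two_of_three:
  "of_bool x + of_bool y + of_bool z = (2::nat) \<longleftrightarrow>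
     x \<and> y \<and> \<not> z \<or> x \<and> \<not> y \<and> z \<or> \<not> x \<and> y \<and> z"
  by (cases x; cases y; cases z) auto

text \<open>
  Both ends of the graph are copies of \<open>K\<^bsub>2,3\<^esub>\<close>: the vertices with memberships \<open>x\<close> and \<open>y\<close> are adjacent to
  the whole three-element column, and each column vertex has one further neighbour. If a column vertex
  is selected, then so is \<open>x\<close> or \<open>y\<close>, which forces two selected column vertices; they stop if both \<open>x\<close>
  and \<open>y\<close> are present and continue if only one is.
\<close>
lemma profile_cap:
  assumes "x \<Longrightarrow> card C = 2" "y \<Longrightarrow> card C = 2"
    and "\<And>j. j \<in> C \<Longrightarrow> of_bool x + of_bool y + of_bool (j \<in> D) = (2::nat)"
  shows "profile C D (of_bool x + of_bool y + card C)"
proof (cases "C = {}")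
  case True
  then show ?thesis using assms(1,2) by (auto simp: profile_def)
next
  case False
  with assms(3) have "x \<or> y" unfolding two_of_three by blast
  with assms(1,2) have "card C = 2" by blast
  with assms(3) show ?thesis
    unfolding two_of_three by (cases x; cases y) (auto simp: profile_def)
qed

text \<open>
  The hub of the column \<open>D\<close>, with membership \<open>m\<close>, is adjacent to all of the column. After an empty
  column, a selected vertex needs the hub and continues, so a new pair of rows starts. A continuing
  pair stays the same pair, since a third row would need the hub, which already has its two neighbours;
  the pair stops exactly if the hub is selected. After a stopping pair only one row is left, which cannot
  have degree two, so the column is empty. The gain of the column is thus compared with 2 in each case;
  truncation at 0 in the subtraction only makes the bound weaker.
\<close>
lemma profile_step:
  assumes "profile C D w" "C \<subseteq> {1,2,3}" "D \<subseteq> {1,2,3}"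
    and m: "m \<Longrightarrow> card D = 2"
    and deg: "\<And>j. j \<in> D \<Longrightarrow> of_bool m + of_bool (j \<in> C) + of_bool (j \<in> E) = (2::nat)"
  shows "profile D E (w + of_bool m + card D - 2)"
proof -
  have fin: "finite C" "finite D" using assms(2,3) by (auto intro: finite_subset)
  consider (empty) "C = {}" "w \<le> 2" | (cont) "card C = 2" "C \<subseteq> D" "w \<le> 3"
    | (stop) "card C = 2" "C \<inter> D = {}" "w \<le> 4"
    using assms(1) unfolding profile_def by blast
  then show ?thesis
  proof cases
    case empty
    show ?thesis
    proof (cases "D = {}")
      case True
      then show ?thesis using empty m by (cases m) (auto simp: profile_def)
    next
      case False
      with deg empty have m and "D \<subseteq> E" unfolding two_of_three by blast+
      with empty m show ?thesis by (simp add: profile_def)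
    qed
  next
    case cont
    \<comment> \<open>With the hub, equality follows from the cardinalities; without it, degree two needs the row in \<open>C\<close>.\<close>
    have "D = C"
    proof (cases m)
      case True
      with m cont fin show ?thesis by (metis card_subset_eq)
    next
      case False
      with deg cont show ?thesis unfolding two_of_three by blast
    qed
    with cont deg show ?thesis
      unfolding two_of_three by (cases m) (auto simp: profile_def)
  next
    case stop
    have "card C + card D \<le> card {1,2,3::nat}"
      using assms(2,3) by (subst card_Un_disjoint[OF fin stop(2), symmetric]) (intro card_mono, auto)
    then have "\<not> m" using m stop by auto
    moreover have "D = {}"
      using deg stop \<open>\<not> m\<close> unfolding two_of_three by blast
    ultimately show ?thesis using stop by (simp add: profile_def)
  qed
qed

section \<open>The two triangles\<close>

text \<open>
  In a triangle whose vertices have one outer neighbour each, a single selected vertex would have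
  degree at most one, two selected ones need both of their outer neighbours, and three need none.
\<close>
lemma triangle_cases:
  assumes "x \<Longrightarrow> of_bool x' + of_bool y + of_bool z = (2::nat)"
    and "y \<Longrightarrow> of_bool y' + of_bool x + of_bool z = (2::nat)"
    and "z \<Longrightarrow> of_bool z' + of_bool x + of_bool y = (2::nat)"
  obtains "x" "y" "z" "\<not> x'" "\<not> y'" "\<not> z'" | "x" "y" "\<not> z" "x'" "y'"
    | "x" "\<not> y" "z" "x'" "z'" | "\<not> x" "y" "z" "y'" "z'" | "\<not> x" "\<not> y" "\<not> z"
  using assms unfolding two_of_three by blast

text \<open>
  The seven ways in which a profile can meet three rows, as lists of literals: this lets the
  case analysis of the triangles be closed by propositional contradictions.
\<close>
lemma profile_cases:
  assumes "profile C D w" "C \<subseteq> {1,2,3}"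
  obtains "1 \<notin> C" "2 \<notin> C" "3 \<notin> C" "w \<le> 2"
    | "1 \<in> C" "2 \<in> C" "3 \<notin> C" "1 \<in> D" "2 \<in> D" "w \<le> 3"
    | "1 \<in> C" "2 \<notin> C" "3 \<in> C" "1 \<in> D" "3 \<in> D" "w \<le> 3"
    | "1 \<notin> C" "2 \<in> C" "3 \<in> C" "2 \<in> D" "3 \<in> D" "w \<le> 3"
    | "1 \<in> C" "2 \<in> C" "3 \<notin> C" "1 \<notin> D" "2 \<notin> D" "w \<le> 4"
    | "1 \<in> C" "2 \<notin> C" "3 \<in> C" "1 \<notin> D" "3 \<notin> D" "w \<le> 4"
    | "1 \<notin> C" "2 \<in> C" "3 \<in> C" "2 \<notin> D" "3 \<notin> D" "w \<le> 4"
proof -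
  have two: "1 \<in> C \<and> 2 \<in> C \<and> 3 \<notin> C \<or> 1 \<in> C \<and> 2 \<notin> C \<and> 3 \<in> C \<or> 1 \<notin> C \<and> 2 \<in> C \<and> 3 \<in> C"
    if "card C = 2"
    using that card_subset_123[OF assms(2)] two_of_three[of "1 \<in> C" "2 \<in> C" "3 \<in> C"] by simp
  note goal = that
  consider "C = {}" "w \<le> 2" | "card C = 2" "C \<subseteq> D" "w \<le> 3" | "card C = 2" "C \<inter> D = {}" "w \<le> 4"
    using assms(1) unfolding profile_def by blast
  then show thesis
  proof cases
    case 1
    show thesis by (rule goal(1)) (simp_all add: 1)
  next
    case 2
    from two[OF 2(1)] show thesis
    proof (elim disjE conjE)
      show thesis if "1 \<in> C" "2 \<in> C" "3 \<notin> C" by (rule goal(2)) (use 2 that in auto)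
      show thesis if "1 \<in> C" "2 \<notin> C" "3 \<in> C" by (rule goal(3)) (use 2 that in auto)
      show thesis if "1 \<notin> C" "2 \<in> C" "3 \<in> C" by (rule goal(4)) (use 2 that in auto)
    qed
  next
    case 3
    from two[OF 3(1)] show thesis
    proof (elim disjE conjE)
      show thesis if "1 \<in> C" "2 \<in> C" "3 \<notin> C" by (rule goal(5)) (use 3 that in auto)
      show thesis if "1 \<in> C" "2 \<notin> C" "3 \<in> C" by (rule goal(6)) (use 3 that in auto)
      show thesis if "1 \<notin> C" "2 \<in> C" "3 \<in> C" by (rule goal(7)) (use 3 that in auto)
    qed
  qed
qed

text \<open>
  The triangles use three vertices seen from the left, of which \<open>Q\<close> is the selected part, and three
  seen from the right, with selected part \<open>X\<close>: one triangle consists of 1 and 2 on the left and 1 on the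
  right, the other one of 3 on the left and 2 and 3 on the right. \<open>P\<close> and \<open>Y\<close> are the selected parts of
  the adjoining columns on the two sides.

  To see why 10 is the bound, distribute the excesses \<open>w - 2\<close> and \<open>w' - 2\<close> over the elements of \<open>P\<close> and
  \<open>Y\<close>: 1/2 for each continuing and 1 for each stopping element, charged to the triangle next
  to it. It remains to see that selected triangle vertices and charges add up to at most 6. A full
  triangle has no charge; an empty one has at most three stopping neighbours; a triangle with two
  selected vertices has two continuing neighbours, hence amounts to 3 unless its third neighbour is
  stopping, and then to 4. In this last case the continuing neighbours are exactly \<open>P\<close> (or exactly
  \<open>Y\<close>), because a profile never mixes the two kinds. The other triangle is then next to a single
  charged element, which is stopping; so it is empty and amounts to 1. The formal proof
  runs through all combinations of the cases for the triangles and the profiles.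
\<close>
lemma two_triangles_le:
  assumes P: "profile P Q w" "P \<subseteq> {1,2,3}" and Q: "Q \<subseteq> {1,2,3}"
    and Y: "profile Y X w'" "Y \<subseteq> {1,2,3}" and X: "X \<subseteq> {1,2,3}"
    and "1 \<in> Q \<Longrightarrow> of_bool (1 \<in> P) + of_bool (2 \<in> Q) + of_bool (1 \<in> X) = (2::nat)"
    and "2 \<in> Q \<Longrightarrow> of_bool (2 \<in> P) + of_bool (1 \<in> Q) + of_bool (1 \<in> X) = (2::nat)"
    and "1 \<in> X \<Longrightarrow> of_bool (1 \<in> Y) + of_bool (1 \<in> Q) + of_bool (2 \<in> Q) = (2::nat)"
    and "3 \<in> Q \<Longrightarrow> of_bool (3 \<in> P) + of_bool (2 \<in> X) + of_bool (3 \<in> X) = (2::nat)"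
    and "2 \<in> X \<Longrightarrow> of_bool (2 \<in> Y) + of_bool (3 \<in> Q) + of_bool (3 \<in> X) = (2::nat)"
    and "3 \<in> X \<Longrightarrow> of_bool (3 \<in> Y) + of_bool (3 \<in> Q) + of_bool (2 \<in> X) = (2::nat)"
  shows "w + card Q + card X + w' \<le> 10"
proof -
  note T1 = triangle_cases[OF assms(7,8,9)]
  note T2 = triangle_cases[OF assms(10,11,12)]
  note p = profile_cases[OF P]
  note y = profile_cases[OF Y]
  \<comment> \<open>Discarding contradictory combinations after each split keeps the product of the four case
    distinctions small.\<close>
  show ?thesis
    unfolding card_subset_123[OF Q] card_subset_123[OF X]
    by (rule T1; rule p; (erule (1) notE)?; rule T2; (erule (1) notE)?; rule y; (erule (1) notE)?)
      simp_all
qed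

section \<open>The upper and the lower bound\<close>

lemma card_induced_2_regular_H_le:
  assumes "S \<subseteq> H_verts k" "regular_graph 2 (with_proj (H k) \<restriction> S)"
  shows "card S \<le> 2 * k + 10"
proof -
  define C where "C i = {j \<in> {1,2,3}. U j i \<in> S}" for i
  define X where "X = {j \<in> {1,2,3}. V j \<in> S}"
  define Y where "Y = {j \<in> {1,2,3}. Z j \<in> S}"
  define W where "W i = of_bool (A 1 \<in> S) + of_bool (A 2 \<in> S)
    + (\<Sum>t\<le>i. card (C t)) + (\<Sum>t=1..i. of_bool (M t \<in> S))" for i
  have deg: "sum_list (map (\<lambda>w. of_bool (w \<in> S)) (H_nbs k v)) = (2::nat)" if "v \<in> S" for v
    using assms regular_2_induced_H_iff that by blast
  have C[simp]: "C i \<subseteq> {1,2,3}" for i unfolding C_def by blast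
  have X[simp]: "X \<subseteq> {1,2,3}" unfolding X_def by blast
  have Y[simp]: "Y \<subseteq> {1,2,3}" unfolding Y_def by blast
  \<comment> \<open>The surplus \<open>w\<close> is a natural number, while a sparse selection may have fewer than \<open>2 * i\<close>
    vertices up to column \<open>i\<close>; hence an inequality.\<close>
  have columns: "\<exists>w. profile (C i) (C (i + 1)) w \<and> W i \<le> w + 2 * i" if "i \<le> k" for i
    using that
  proof (induction i)
    case 0
    have "profile (C 0) (C 1) (of_bool (A 1 \<in> S) + of_bool (A 2 \<in> S) + card (C 0))"
    proof (rule profile_cap)
      show "card (C 0) = 2" if "A 1 \<in> S" using deg[OF that] unfolding C_def card_filter_123 by simp
      show "card (C 0) = 2" if "A 2 \<in> S" using deg[OF that] unfolding C_def card_filter_123 by simp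
      show "of_bool (A 1 \<in> S) + of_bool (A 2 \<in> S) + of_bool (j \<in> C 1) = (2::nat)"
        if "j \<in> C 0" for j
        using that deg[of "U j 0"] unfolding C_def by auto
    qed
    then show ?case by (intro exI conjI) (auto simp: W_def)
  next
    case (Suc i)
    then obtain w where w: "profile (C i) (C (i + 1)) w" "W i \<le> w + 2 * i" by auto
    let ?w' = "w + of_bool (M (i + 1) \<in> S) + card (C (i + 1)) - 2"
    have "profile (C (i + 1)) (C (i + 2)) ?w'"
    proof (rule profile_step[OF w(1) C C])
      show "card (C (i + 1)) = 2" if "M (i + 1) \<in> S"
        using deg[OF that] unfolding C_def card_filter_123 by simp
      show "of_bool (M (i + 1) \<in> S) + of_bool (j \<in> C i) + of_bool (j \<in> C (i + 2)) = (2::nat)"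
        if "j \<in> C (i + 1)" for j
        using that deg[of "U j (i + 1)"] Suc.prems unfolding C_def by auto
    qed
    moreover have "W (Suc i) \<le> ?w' + 2 * Suc i"
      using w(2) unfolding W_def by simp
    ultimately show ?case by auto
  qed
  then obtain w where w: "profile (C k) (C (k + 1)) w" "W k \<le> w + 2 * k" by blast
  have right: "profile Y X (of_bool (B 1 \<in> S) + of_bool (B 2 \<in> S) + card Y)"
  proof (rule profile_cap)
    show "card Y = 2" if "B 1 \<in> S" using deg[OF that] unfolding Y_def card_filter_123 by simp
    show "card Y = 2" if "B 2 \<in> S" using deg[OF that] unfolding Y_def card_filter_123 by simp
    show "of_bool (B 1 \<in> S) + of_bool (B 2 \<in> S) + of_bool (j \<in> X) = (2::nat)"
      if "j \<in> Y" for j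
      using that deg[of "Z j"] unfolding X_def Y_def by auto
  qed
  have "w + card (C (k + 1)) + card X + (of_bool (B 1 \<in> S) + of_bool (B 2 \<in> S) + card Y) \<le> 10"
    by (rule two_triangles_le[OF w(1) C C right Y X])
      (use deg[of "U 1 (k + 1)"] deg[of "U 2 (k + 1)"] deg[of "U 3 (k + 1)"]
        deg[of "V 1"] deg[of "V 2"] deg[of "V 3"] in \<open>auto simp: C_def X_def Y_def\<close>)
  moreover have "card S = W k + card (C (k + 1)) + card X + card Y
      + of_bool (B 1 \<in> S) + of_bool (B 2 \<in> S)"
    unfolding card_subset_H_verts[OF assms(1)] W_def C_def X_def Y_def by simp
  ultimately show ?thesis using w(2) by simp
qed

text \<open>
  The witness consists of the cycle through \<open>A 1\<close> and the first two rows, closed by the edge between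
  their last vertices, and of the cycle through \<open>V 2\<close>, \<open>V 3\<close>, \<open>Z 3\<close>, \<open>B 1\<close>, \<open>Z 2\<close>. No edge joins the two,
  because the third row and \<open>V 1\<close>, \<open>Z 1\<close> are left out.
\<close>
lemma induced_2_regular_H_witness:
  "\<exists>S \<subseteq> H_verts k. regular_graph 2 (with_proj (H k) \<restriction> S) \<and> card S = 2 * k + 10"
proof -
  define S where "S = (\<lambda>(j, i). U j i) ` ({1,2} \<times> {..k + 1}) \<union> {A 1, V 2, V 3, Z 2, Z 3, B 1}"
  have sub: "S \<subseteq> H_verts k" unfolding S_def by auto
  have mem: "U j i \<in> S \<longleftrightarrow> (j = 1 \<or> j = 2) \<and> i \<le> k + 1" "A j \<in> S \<longleftrightarrow> j = 1" "M i \<notin> S"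
    "V j \<in> S \<longleftrightarrow> j = 2 \<or> j = 3" "Z j \<in> S \<longleftrightarrow> j = 2 \<or> j = 3" "B j \<in> S \<longleftrightarrow> j = 1" for j i
    unfolding S_def by auto
  have "sum_list (map (\<lambda>w. of_bool (w \<in> S)) (H_nbs k v)) = (2::nat)" if "v \<in> S" for v
    using that by (cases v) (auto simp: mem)
  then have "regular_graph 2 (with_proj (H k) \<restriction> S)"
    using regular_2_induced_H_iff[OF sub] by blast
  moreover have "card S = 2 * k + 10"
  proof -
    have "card S = card ((\<lambda>(j, i). U j i) ` ({1::nat,2} \<times> {..k + 1}))
        + card {A 1, V 2, V 3, Z 2, Z 3, B 1}"
      unfolding S_def by (rule card_Un_disjoint) auto
    also have "card ((\<lambda>(j, i). U j i) ` ({1::nat,2} \<times> {..k + 1})) = 2 * (k + 2)"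
      by (subst card_image) (auto simp: inj_on_def card_cartesian_product)
    finally show ?thesis by simp
  qed
  ultimately show ?thesis using sub by blast
qed

theorem theorem16:
  fixes k n :: nat
  assumes "k \<ge> 1" and "n = 4 * k + 16"
  shows "real (c_ind (with_proj (H k))) = real n / 2 + 2"
proof -
  have verts: "verts (with_proj (H k)) = H_verts k" by (simp add: H_def)
  have fin: "finite (verts (with_proj (H k)))" unfolding verts by (simp add: H_verts_eq)
  have "c_ind (with_proj (H k)) = 2 * k + 10"
  proof (rule antisym)
    show "c_ind (with_proj (H k)) \<le> 2 * k + 10"
      using c_ind_attained[OF fin] card_induced_2_regular_H_le unfolding verts by metis
    show "2 * k + 10 \<le> c_ind (with_proj (H k))"
      using induced_2_regular_H_witness card_le_c_ind[OF fin] unfolding verts by metis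
  qed
  then show ?thesis using assms(2) by simp
qed

end
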